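(* Let $d>0$. Let $\tau=\{t_n,\ n\in\mathbb{Z}\}$ be any sampling point process satisfying Assumptions A1, A3 and A4 (stated in the context, A4 with this $d$). Then $\tau$ is not alias-free, in the sense of Definition 2 (stated in the context), relative to the class $\mathbb{S}$ of all spectra. That is, there exist two processes with different spectral distributions that yield the same covariance measure $\mu_z$ of the compound process.
   Context: Processes: $X=\{X(t),\ -\infty<t<\infty\}$ denotes a real, mean square continuous, wide sense stationary stochastic process with mean zero, covariance function $C(t)=E[X(s+t)X(s)]$ and spectral distribution (spectrum) $\Phi$, i.e. the finite measure on $\mathbb{R}$ with $C(t)=\int_{-\infty}^{\infty}e^{i\lambda t}\,d\Phi(\lambda)$ (up to an immaterial normalizing constant). The class of all spectra is the class of spectral distributions of all such processes. Sampling process: $\tau=\{t_n,\ n=\ldots,-2,-1,0,1,2,\ldots\}$ is a sequence of real-valued, stochastic sampling times. Assumption A1: the process $\tau$ is independent of $X$ (for every process $X$ considered). Assumption A3: the process $\tau$ constitutes a stationary orderly second-order point process on the real line. (Orderly: the probability of two or more points in an interval of length $h$ is $o(h)$ as $h\downarrow0$. Second-order: the number $N(B)$ of points in any bounded Borel set $B$ has finite second moment.) Assumption A4: the time separation between two successive sample points is at least $d$, i.e. $t_{n+1}-t_n\ge d$ for every index $n$, for the fixed $d>0$. Let $\mathbb{B}$ be the Borel $\sigma$-field on $\mathbb{R}$. Let $\beta$ be the mean intensity of $\tau$ ($E[N(B)]=\beta|B|$, with $|B|$ the Lebesgue measure of $B$) and let $\mu_c$ be its reduced covariance measure, i.e.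 $\mathrm{Cov}(N(A),N(B))=\int_A\mu_c(B-x)\,dx$ for bounded Borel sets $A,B$. The compound process is $Z=\{Z(B),\ B\in\mathbb{B}\}$ with $Z(B)=\sum_{t_i\in B}X(t_i)$. It is second order stationary, and its (reduced) covariance measure $\mu_z$ is given by $$\mu_z(B)=\int_B C(u)\,[\beta^2\,du+\mu_c(du)].$$ Definition 2: a sampling process $\tau$ satisfying A1 and A3 is alias-free relative to a class of spectra $\mathbb{S}$ if no two random processes with different spectra belonging to $\mathbb{S}$ yield the same covariance measure $\mu_z$ of the compound process. *)

theory Defs
  imports "HOL-Probability.Probability"
begin

text \<open>
  Joint measurability is needed for the sampled values \<open>X (t n \<omega>) \<omega>'\<close> to be random variables.
  Every mean square continuous process has a jointly measurable version, so this does not change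
  the class of covariance functions or of spectra.
\<close>

definition wss_process :: "'b measure \<Rightarrow> (real \<Rightarrow> 'b \<Rightarrow> real) \<Rightarrow> bool" where
  "wss_process Q X \<longleftrightarrow>
     prob_space Q \<and>
     case_prod X \<in> borel_measurable (borel \<Otimes>\<^sub>M Q) \<and>
     (\<forall>t. integrable Q (\<lambda>\<omega>. (X t \<omega>)\<^sup>2)) \<and>
     (\<forall>t. (\<integral>\<omega>. X t \<omega> \<partial>Q) = 0) \<and>
     (\<forall>s s' t. (\<integral>\<omega>. X (s + t) \<omega> * X s \<omega> \<partial>Q) = (\<integral>\<omega>. X (s' + t) \<omega> * X s' \<omega> \<partial>Q)) \<and>
     (\<forall>t. ((\<lambda>s. \<integral>\<omega>. (X s \<omega> - X t \<omega>)\<^sup>2 \<partial>Q) \<longlongrightarrow> 0) (at t))"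

definition covariance_function :: "'b measure \<Rightarrow> (real \<Rightarrow> 'b \<Rightarrow> real) \<Rightarrow> real \<Rightarrow> real" where
  "covariance_function Q X t = (\<integral>\<omega>. X t \<omega> * X 0 \<omega> \<partial>Q)"

text \<open>\<^term>\<open>char \<Phi> t\<close> is the integral of \<open>exp (\<i> * t * x)\<close> over \<open>x\<close> with respect to \<open>\<Phi>\<close>.\<close>

definition spectrum_of :: "'b measure \<Rightarrow> (real \<Rightarrow> 'b \<Rightarrow> real) \<Rightarrow> real measure \<Rightarrow> bool" where
  "spectrum_of Q X \<Phi> \<longleftrightarrow>
     finite_measure \<Phi> \<and> sets \<Phi> = sets borel \<and>
     (\<forall>t. complex_of_real (covariance_function Q X t) = char \<Phi> t)"

text \<open>
  HOL cannot quantify over the type of the sample space, so that type is a parameter. A jointly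
  measurable process factors as \<open>X t \<omega> = h t (g \<omega>)\<close> with \<open>g\<close> real-valued and \<open>h\<close> Borel, because
  only countably many events of \<open>Q\<close> are involved; hence any type from which \<open>real\<close> can be
  recovered by a Borel map, such as \<open>real\<close> or \<open>real \<times> real\<close>, yields the full class.
\<close>

definition all_spectra :: "'b itself \<Rightarrow> real measure set" where
  "all_spectra _ = {\<Phi>. \<exists>(Q :: 'b measure) X. wss_process Q X \<and> spectrum_of Q X \<Phi>}"

text \<open>The number of indices \<open>n\<close> with \<open>t n \<omega> \<in> B\<close>, with value \<open>\<infinity>\<close> if there are infinitely many.\<close>

definition count_in :: "(int \<Rightarrow> 'a \<Rightarrow> real) \<Rightarrow> real set \<Rightarrow> 'a \<Rightarrow> ennreal" where
  "count_in t B \<omega> = emeasure (count_space UNIV) {n. t n \<omega> \<in> B}"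

abbreviation bounded_borel :: "real set set" where
  "bounded_borel \<equiv> {B \<in> sets borel. bounded B}"

definition random_times :: "'a measure \<Rightarrow> (int \<Rightarrow> 'a \<Rightarrow> real) \<Rightarrow> bool" where
  "random_times M t \<longleftrightarrow> prob_space M \<and> (\<forall>n. t n \<in> borel_measurable M)"

definition second_order_times :: "'a measure \<Rightarrow> (int \<Rightarrow> 'a \<Rightarrow> real) \<Rightarrow> bool" where
  "second_order_times M t \<longleftrightarrow>
     (\<forall>B \<in> bounded_borel. (\<integral>\<^sup>+\<omega>. (count_in t B \<omega>)\<^sup>2 \<partial>M) < \<infinity>)"

definition stationary_times :: "'a measure \<Rightarrow> (int \<Rightarrow> 'a \<Rightarrow> real) \<Rightarrow> bool" where
  "stationary_times M t \<longleftrightarrow>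
     (\<forall>(k::nat) (B :: nat \<Rightarrow> real set) h. (\<forall>i<k. B i \<in> bounded_borel) \<longrightarrow>
        distr M (\<Pi>\<^sub>M i\<in>{..<k}. borel) (\<lambda>\<omega>. \<lambda>i\<in>{..<k}. count_in t ((\<lambda>x. x + h) ` B i) \<omega>) =
        distr M (\<Pi>\<^sub>M i\<in>{..<k}. borel) (\<lambda>\<omega>. \<lambda>i\<in>{..<k}. count_in t (B i) \<omega>))"

definition orderly_times :: "'a measure \<Rightarrow> (int \<Rightarrow> 'a \<Rightarrow> real) \<Rightarrow> bool" where
  "orderly_times M t \<longleftrightarrow>
     (\<forall>x. (\<lambda>h. measure M {\<omega> \<in> space M. count_in t {x..<x + h} \<omega> \<ge> 2}) \<in> o[at_right 0](\<lambda>h. h))"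

definition separated_times :: "real \<Rightarrow> 'a measure \<Rightarrow> (int \<Rightarrow> 'a \<Rightarrow> real) \<Rightarrow> bool" where
  "separated_times d M t \<longleftrightarrow> (AE \<omega> in M. \<forall>n. t (n + 1) \<omega> - t n \<omega> \<ge> d)"

text \<open>
  The sampling times live on \<open>M\<close>, the sampled process on \<open>Q\<close>, and the compound process on
  \<open>M \<Otimes>\<^sub>M Q\<close>. The sampling times are thereby independent of the process (see
  \<open>sampling_independent\<close> below). Nothing is lost, as the joint law of independent
  random elements is determined by the two marginal laws. Independence of
  the family \<open>X r\<close> (\<open>r\<close> real) from the family \<open>t n\<close> on a common probability space would be too
  weak: it does not prevent \<open>X\<close> from being altered at the random times \<open>t n\<close> themselves, since
  for each fixed \<open>r\<close> this affects only a null event.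
\<close>

lemma sampling_independent:
  assumes "prob_space M" "prob_space Q"
  shows "prob_space.indep_var (M \<Otimes>\<^sub>M Q) M fst Q snd"
proof -
  interpret M: prob_space M by fact
  interpret Q: prob_space Q by fact
  interpret P: pair_prob_space M Q ..
  have 1: "distr (M \<Otimes>\<^sub>M Q) M fst = M"
    by (rule Q.distr_pair_fst)
  have 2: "distr (M \<Otimes>\<^sub>M Q) Q snd = Q"
    by (intro measure_eqI)
      (auto simp: emeasure_distr space_pair_measure Times_Int_Times Q.emeasure_pair_measure_Times
        M.emeasure_space_1 snd_vimage_eq_Times dest: sets.sets_into_space intro!: arg_cong2[where f=emeasure])
  show ?thesis
    unfolding P.indep_var_distribution_eq 1 2 by simp
qed

text \<open>The value \<open>0\<close> of a sum over an infinite index set is used only on a null event if \<open>B\<close> is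
  bounded and the sampling times are of second order.\<close>

definition compound_process ::
    "(int \<Rightarrow> 'a \<Rightarrow> real) \<Rightarrow> (real \<Rightarrow> 'b \<Rightarrow> real) \<Rightarrow> real set \<Rightarrow> 'a \<times> 'b \<Rightarrow> real" where
  "compound_process t X B = (\<lambda>(\<omega>, \<omega>'). \<Sum>n\<in>{n. t n \<omega> \<in> B}. X (t n \<omega>) \<omega>')"

text \<open>
  Reduced covariance measures are signed and in general of infinite total variation, so that they
  are defined only on the bounded Borel sets; the values elsewhere are irrelevant.
\<close>

definition signed_measure_on_bounded :: "(real set \<Rightarrow> real) \<Rightarrow> bool" where
  "signed_measure_on_bounded \<mu> \<longleftrightarrow>
     (\<forall>A :: nat \<Rightarrow> real set. range A \<subseteq> sets borel \<longrightarrow> disjoint_family A \<longrightarrow> bounded (\<Union>n. A n) \<longrightarrow>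
        (\<lambda>n. \<mu> (A n)) sums \<mu> (\<Union>n. A n))"

definition cov :: "'c measure \<Rightarrow> ('c \<Rightarrow> real) \<Rightarrow> ('c \<Rightarrow> real) \<Rightarrow> real" where
  "cov P U V =
     (\<integral>\<omega>. (U \<omega> - (\<integral>\<omega>'. U \<omega>' \<partial>P)) * (V \<omega> - (\<integral>\<omega>'. V \<omega>' \<partial>P)) \<partial>P)"

text \<open>
  \<open>\<mu>\<close> is the reduced covariance measure of the set-indexed process \<open>Z\<close>:
  \<open>Cov (Z A, Z B)\<close> is the integral over \<open>x \<in> A\<close> of \<open>\<mu> (B - x)\<close>. For given \<open>Z\<close> this determines
  \<open>\<mu>\<close> on the bounded Borel sets. For the compound process of a stationary second-order \<open>t\<close> with
  mean intensity \<open>\<beta>\<close> and reduced covariance measure \<open>\<mu>\<^sub>c\<close> it is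
  \<open>C u * (\<beta>\<^sup>2 du + \<mu>\<^sub>c (du))\<close>, where \<open>C\<close> is the covariance function of \<open>X\<close>.
\<close>

definition reduced_covariance_measure ::
    "'c measure \<Rightarrow> (real set \<Rightarrow> 'c \<Rightarrow> real) \<Rightarrow> (real set \<Rightarrow> real) \<Rightarrow> bool" where
  "reduced_covariance_measure P Z \<mu> \<longleftrightarrow>
     signed_measure_on_bounded \<mu> \<and>
     (\<forall>B \<in> bounded_borel. Z B \<in> borel_measurable P \<and> integrable P (\<lambda>\<omega>. (Z B \<omega>)\<^sup>2)) \<and>
     (\<forall>A \<in> bounded_borel. \<forall>B \<in> bounded_borel.
        set_integrable lborel A (\<lambda>x. \<mu> ((\<lambda>b. b - x) ` B)) \<and>
        cov P (Z A) (Z B) = (LINT x:A|lborel. \<mu> ((\<lambda>b. b - x) ` B)))"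

text \<open>As in \<open>all_spectra\<close>, the first argument is the type of the sample space of the sampled process.\<close>

definition alias_free ::
    "'b itself \<Rightarrow> 'a measure \<Rightarrow> (int \<Rightarrow> 'a \<Rightarrow> real) \<Rightarrow> real measure set \<Rightarrow> bool" where
  "alias_free _ M t S \<longleftrightarrow>
     \<not> (\<exists>(Q\<^sub>1 :: 'b measure) X\<^sub>1 \<Phi>\<^sub>1 (Q\<^sub>2 :: 'b measure) X\<^sub>2 \<Phi>\<^sub>2 \<mu>.
          wss_process Q\<^sub>1 X\<^sub>1 \<and> spectrum_of Q\<^sub>1 X\<^sub>1 \<Phi>\<^sub>1 \<and> \<Phi>\<^sub>1 \<in> S \<and>
          wss_process Q\<^sub>2 X\<^sub>2 \<and> spectrum_of Q\<^sub>2 X\<^sub>2 \<Phi>\<^sub>2 \<and> \<Phi>\<^sub>2 \<in> S \<and>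
          \<Phi>\<^sub>1 \<noteq> \<Phi>\<^sub>2 \<and>
          reduced_covariance_measure (M \<Otimes>\<^sub>M Q\<^sub>1) (compound_process t X\<^sub>1) \<mu> \<and>
          reduced_covariance_measure (M \<Otimes>\<^sub>M Q\<^sub>2) (compound_process t X\<^sub>2) \<mu>)"

end

theory Submission
  imports Defs
begin

text \<open>
  Sampling times that are at least \<open>d\<close> apart never show the process at two instants with a lag
  strictly between \<open>0\<close> and \<open>d\<close>. The covariance function \<open>C\<close> on that range is therefore invisible in
  the compound process, and it suffices to find two covariance functions that differ only there.

  Two that work vanish at all lags of size at least \<open>d\<close> and have the same value at \<open>0\<close>: the triangles
  \<open>C u = max 0 (1 - \<bar>u\<bar> / a)\<close> for \<open>a = d\<close> and \<open>a = d / 2\<close>. With either one, sampled values at distinct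
  sampling times are uncorrelated, so the covariance of \<open>Z A\<close> and \<open>Z B\<close> is the mean number of
  sampling times in \<open>A \<inter> B\<close>. By stationarity that mean is \<open>\<beta>\<close> times the length of \<open>A \<inter> B\<close>
  (\<open>has_bochner_integral_count\<close>), so both compound processes have the reduced covariance measure
  with a single atom of mass \<open>\<beta>\<close> at \<open>0\<close>
  (\<open>reduced_covariance_measure_compound_process\<close>).

  It remains to exhibit processes with these covariances. The triangle is the characteristic function
  of the Fejer distribution, with density \<open>(1 - cos (a * x)) / (pi * a * x\<^sup>2)\<close>
  (\<open>char_fejer_distribution\<close>). A cosine wave with a random frequency of law \<open>\<Phi>\<close> and an independent
  random phase is a stationary process with covariance \<open>Re (char \<Phi> u)\<close>, hence with spectrum \<open>\<Phi>\<close>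
  if \<open>char \<Phi>\<close> is real (\<open>spectrum_of_random_wave\<close>). A frequency and a phase make up the sample space
  \<open>real \<times> real\<close>.
\<close>

section \<open>Translation-invariant measures and the intensity of the sampling times\<close>

lemma borel_translation:
  fixes B :: "real set"
  assumes "B \<in> sets borel"
  shows "(\<lambda>x. x + h) ` B \<in> sets borel"
proof -
  have "(\<lambda>x. x + h) ` B = (\<lambda>x. x - h) -` B"
    by (force simp: image_iff algebra_simps)
  moreover have "(\<lambda>x. x - h) \<in> borel_measurable borel"
    by measurable
  ultimately show ?thesis
    using assms measurable_sets_borel by metis
qed

text \<open>
  Uniqueness of Lebesgue measure by Fubini's theorem. Averaging \<open>\<nu> (B + x) = \<nu> B\<close> over
  \<open>x \<in> {0..<1}\<close> and exchanging the integrals turns the translates of \<open>B\<close>, measured by \<open>\<nu>\<close>, into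
  translates of the unit interval, which again all have the same \<open>\<nu>\<close>-measure. Invariance is
  assumed only for bounded sets because stationarity of sampling times speaks only of those.
\<close>

lemma emeasure_translation_invariant:
  fixes \<nu> :: "real measure"
  assumes sets_eq [measurable_cong]: "sets \<nu> = sets borel"
    and finite: "\<And>B. B \<in> bounded_borel \<Longrightarrow> emeasure \<nu> B < \<infinity>"
    and inv: "\<And>B h. B \<in> bounded_borel \<Longrightarrow> emeasure \<nu> ((\<lambda>x. x + h) ` B) = emeasure \<nu> B"
    and B: "B \<in> bounded_borel"
  shows "emeasure \<nu> B = emeasure \<nu> {0..<1} * emeasure lborel B"
proof -
  interpret N: sigma_finite_measure \<nu>
  proof
    show "\<exists>A. countable A \<and> A \<subseteq> sets \<nu> \<and> \<Union> A = space \<nu> \<and> (\<forall>a\<in>A. emeasure \<nu> a \<noteq> \<infinity>)"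
    proof (intro exI[of _ "range (\<lambda>n. {- real n..real n})"] conjI ballI)
      show "\<Union> (range (\<lambda>n. {- real n..real n})) = space \<nu>"
      proof -
        have "\<exists>n. - real n \<le> x \<and> x \<le> real n" for x
          using real_arch_simple[of "\<bar>x\<bar>"] by (auto simp: abs_le_iff minus_le_iff)
        then show ?thesis
          using sets_eq_imp_space_eq[OF sets_eq] by auto
      qed
      show "emeasure \<nu> a \<noteq> \<infinity>" if "a \<in> range (\<lambda>n. {- real n..real n})" for a
        using that finite[of a] by auto
    qed (auto simp: sets_eq)
  qed
  interpret LN: pair_sigma_finite lborel \<nu> ..
  have [measurable]: "B \<in> sets borel"
    using B by simp
  have image_ind: "indicator ((\<lambda>y. y + x) ` D) y = (indicator D (y - x) :: ennreal)" for D and x y :: real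
    by (force simp: indicator_def image_iff algebra_simps)
  have shift: "(\<integral>\<^sup>+y. indicator D (y - x) \<partial>\<nu>) = emeasure \<nu> D" if "D \<in> bounded_borel" for D x
    using that borel_translation[of D x] inv[of D x] by (simp add: image_ind[symmetric] sets_eq)
  have "emeasure \<nu> B = (\<integral>\<^sup>+x. indicator {0..<1} (x :: real) * emeasure \<nu> B \<partial>lborel)"
    by (simp add: nn_integral_multc)
  also have "\<dots> = (\<integral>\<^sup>+x. \<integral>\<^sup>+y. indicator {0..<1} x * indicator B (y - x) \<partial>\<nu> \<partial>lborel)"
    using shift[OF B] by (simp add: nn_integral_cmult)
  also have "\<dots> = (\<integral>\<^sup>+y. \<integral>\<^sup>+x. indicator {0..<1} x * indicator B (y - x) \<partial>lborel \<partial>\<nu>)"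
    by (rule LN.Fubini'[symmetric]) measurable
  \<comment> \<open>the reflection \<open>z = y - x\<close> preserves Lebesgue measure\<close>
  also have "\<dots> = (\<integral>\<^sup>+y. \<integral>\<^sup>+z. indicator B z * indicator {0..<1} (y - z) \<partial>lborel \<partial>\<nu>)"
  proof (rule nn_integral_cong)
    fix y
    show "(\<integral>\<^sup>+x. indicator {0..<1} x * indicator B (y - x) \<partial>lborel)
        = (\<integral>\<^sup>+z. indicator B z * indicator {0..<1} (y - z) \<partial>lborel)"
      by (subst nn_integral_real_affine[where c = "-1" and t = y]) (simp_all add: mult.commute)
  qed
  also have "\<dots> = (\<integral>\<^sup>+z. \<integral>\<^sup>+y. indicator B z * indicator {0..<1} (y - z) \<partial>\<nu> \<partial>lborel)"
    by (rule LN.Fubini') measurable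
  also have "\<dots> = (\<integral>\<^sup>+z. indicator B z * emeasure \<nu> {0..<1} \<partial>lborel)"
    using shift[of "{0..<1}"] by (simp add: nn_integral_cmult)
  also have "\<dots> = emeasure \<nu> {0..<1} * emeasure lborel B"
    by (simp add: nn_integral_multc mult.commute)
  finally show ?thesis .
qed

locale stationary_sampling = prob_space M for M :: "'a measure" +
  fixes t :: "int \<Rightarrow> 'a \<Rightarrow> real"
  assumes times_measurable [measurable]: "\<And>n. t n \<in> borel_measurable M"
    and stationary: "stationary_times M t"
    and second_order: "second_order_times M t"
begin

lemma measurable_times_pair [measurable]: "(\<lambda>(n, \<omega>). t n \<omega>) \<in> borel_measurable (count_space UNIV \<Otimes>\<^sub>M M)"
  by (rule measurable_pair_measure_countable1) auto

lemma measurable_count_in [measurable]: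
  assumes [measurable]: "B \<in> sets borel"
  shows "count_in t B \<in> borel_measurable M"
proof -
  interpret pair_sigma_finite "count_space (UNIV :: int set)" M
    by (intro pair_sigma_finite.intro sigma_finite_measure_count_space sigma_finite_measure_axioms)
  let ?S = "{z \<in> space (count_space UNIV \<Otimes>\<^sub>M M). (\<lambda>(n, \<omega>). t n \<omega>) z \<in> B}"
  have "(\<lambda>\<omega>. emeasure (count_space UNIV) ((\<lambda>n. (n, \<omega>)) -` ?S)) \<in> borel_measurable M"
    by (rule measurable_emeasure_Pair2) measurable
  then show ?thesis
    by (rule measurable_cong[THEN iffD1, rotated]) (simp add: count_in_def space_pair_measure)
qed

text \<open>
  The mean measure of the sampling times. As the image of a product measure it is a measure by
  construction, and its integrals are double integrals over the index and the sample point.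
\<close>

definition intensity :: "real measure" where
  "intensity = distr (count_space UNIV \<Otimes>\<^sub>M M) borel (\<lambda>(n, \<omega>). t n \<omega>)"

lemma emeasure_intensity:
  assumes [measurable]: "B \<in> sets borel"
  shows "emeasure intensity B = (\<integral>\<^sup>+\<omega>. count_in t B \<omega> \<partial>M)"
proof -
  interpret pair_sigma_finite "count_space (UNIV :: int set)" M
    by (intro pair_sigma_finite.intro sigma_finite_measure_count_space sigma_finite_measure_axioms)
  let ?S = "(\<lambda>(n, \<omega>). t n \<omega>) -` B \<inter> space (count_space UNIV \<Otimes>\<^sub>M M)"
  have "emeasure intensity B = emeasure (count_space UNIV \<Otimes>\<^sub>M M) ?S"
    unfolding intensity_def by (rule emeasure_distr) measurable
  also have "\<dots> = (\<integral>\<^sup>+\<omega>. emeasure (count_space UNIV) ((\<lambda>n. (n, \<omega>)) -` ?S) \<partial>M)"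
    by (rule emeasure_pair_measure_alt2) measurable
  also have "\<dots> = (\<integral>\<^sup>+\<omega>. count_in t B \<omega> \<partial>M)"
    by (intro nn_integral_cong) (simp add: count_in_def space_pair_measure vimage_def)
  finally show ?thesis .
qed

text \<open>
  By the one-dimensional case of \<^term>\<open>stationary_times M t\<close>, the counts
  in \<open>B\<close> and in its translate have the same law, hence the same mean.
\<close>

lemma nn_integral_count_in_shift:
  assumes B: "B \<in> bounded_borel"
  shows "(\<integral>\<^sup>+\<omega>. count_in t ((\<lambda>x. x + h) ` B) \<omega> \<partial>M) = (\<integral>\<^sup>+\<omega>. count_in t B \<omega> \<partial>M)"
proof -
  have joint: "(\<lambda>\<omega>. \<lambda>i\<in>{..<1::nat}. count_in t D \<omega>) \<in> M \<rightarrow>\<^sub>M (\<Pi>\<^sub>M i\<in>{..<1}. borel)"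
    if "D = (\<lambda>x. x + h) ` B \<or> D = B" for D
    using that B borel_translation[of B h] by (intro measurable_restrict measurable_count_in) auto
  have first: "(\<lambda>x :: nat \<Rightarrow> ennreal. x 0) \<in> borel_measurable (\<Pi>\<^sub>M i\<in>{..<1}. borel)"
    by (rule measurable_component_singleton) simp
  have "distr M (\<Pi>\<^sub>M i\<in>{..<1}. borel) (\<lambda>\<omega>. \<lambda>i\<in>{..<1::nat}. count_in t ((\<lambda>x. x + h) ` B) \<omega>) =
      distr M (\<Pi>\<^sub>M i\<in>{..<1}. borel) (\<lambda>\<omega>. \<lambda>i\<in>{..<1::nat}. count_in t B \<omega>)" (is "?D1 = ?D2")
    using stationary B unfolding stationary_times_def
    by (elim allE[of _ 1] allE[of _ "\<lambda>_. B"] allE[of _ h]) simp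
  then have "(\<integral>\<^sup>+x. x 0 \<partial>?D1) = (\<integral>\<^sup>+x. x 0 \<partial>?D2)"
    by simp
  then show ?thesis
    using joint first by (simp add: nn_integral_distr)
qed

text \<open>
  Counts are natural numbers or \<open>\<infinity>\<close>, so a finite second moment bounds the first.
\<close>

lemma count_in_le_square: "count_in t B \<omega> \<le> (count_in t B \<omega>)\<^sup>2"
proof (cases "finite {n. t n \<omega> \<in> B}")
  case True
  have "real k \<le> (real k)\<^sup>2" for k :: nat
    by (cases k) (simp_all add: power2_eq_square)
  with True show ?thesis
    by (simp add: count_in_def ennreal_of_nat_eq_real_of_nat ennreal_power)
next
  case False
  then show ?thesis
    by (simp add: count_in_def power2_eq_square)
qed

lemma nn_integral_count_in_finite:
  assumes "B \<in> bounded_borel"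
  shows "(\<integral>\<^sup>+\<omega>. count_in t B \<omega> \<partial>M) < \<infinity>"
proof -
  have "(\<integral>\<^sup>+\<omega>. count_in t B \<omega> \<partial>M) \<le> (\<integral>\<^sup>+\<omega>. (count_in t B \<omega>)\<^sup>2 \<partial>M)"
    by (intro nn_integral_mono count_in_le_square)
  also have "\<dots> < \<infinity>"
    using second_order assms by (simp add: second_order_times_def)
  finally show ?thesis .
qed

lemma AE_finite_count:
  assumes "B \<in> bounded_borel"
  shows "AE \<omega> in M. finite {n. t n \<omega> \<in> B}"
proof -
  have "AE \<omega> in M. count_in t B \<omega> \<noteq> \<infinity>"
    using nn_integral_count_in_finite[OF assms] assms by (intro nn_integral_PInf_AE) auto
  then show ?thesis
    by eventually_elim (auto simp: count_in_def emeasure_count_space split: if_splits)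
qed

definition mean_intensity :: real where
  "mean_intensity = enn2real (\<integral>\<^sup>+\<omega>. count_in t {0..<1} \<omega> \<partial>M)"

text \<open>
  The mean measure is finite on bounded sets and translation invariant, hence a multiple of Lebesgue
  measure. The junk value \<open>0\<close> of \<^const>\<open>card\<close> on infinite sets occurs only on a null event.
\<close>

lemma has_bochner_integral_count:
  assumes B: "B \<in> bounded_borel"
  shows "has_bochner_integral M (\<lambda>\<omega>. real (card {n. t n \<omega> \<in> B})) (mean_intensity * measure lborel B)"
proof (rule has_bochner_integral_nn_integral)
  have enn2real: "real (card {n. t n \<omega> \<in> B}) = enn2real (count_in t B \<omega>)" for \<omega>
    by (cases "finite {n. t n \<omega> \<in> B}") (simp_all add: count_in_def ennreal_of_nat_eq_real_of_nat)
  show "(\<lambda>\<omega>. real (card {n. t n \<omega> \<in> B})) \<in> borel_measurable M"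
    unfolding enn2real using B by (intro borel_measurable_enn2real measurable_count_in) simp
  have "(\<integral>\<^sup>+\<omega>. ennreal (real (card {n. t n \<omega> \<in> B})) \<partial>M) = (\<integral>\<^sup>+\<omega>. count_in t B \<omega> \<partial>M)"
    using AE_finite_count[OF B]
    by (intro nn_integral_cong_AE, eventually_elim) (simp add: count_in_def ennreal_of_nat_eq_real_of_nat)
  also have "\<dots> = emeasure intensity B"
    using B by (simp add: emeasure_intensity)
  also have "\<dots> = emeasure intensity {0..<1} * emeasure lborel B"
  proof (rule emeasure_translation_invariant[OF _ _ _ B])
    show "sets intensity = sets borel"
      by (simp add: intensity_def)
    show "emeasure intensity D < \<infinity>" if "D \<in> bounded_borel" for D
      using that nn_integral_count_in_finite by (simp add: emeasure_intensity)
    fix D h assume D: "D \<in> bounded_borel"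
    show "emeasure intensity ((\<lambda>x. x + h) ` D) = emeasure intensity D"
      using D borel_translation nn_integral_count_in_shift by (simp add: emeasure_intensity)
  qed
  also have "emeasure intensity {0..<1} = ennreal mean_intensity"
    using nn_integral_count_in_finite[of "{0..<1}"] by (simp add: emeasure_intensity mean_intensity_def)
  also have "emeasure lborel B = ennreal (measure lborel B)"
    using B emeasure_bounded_finite[of B] by (simp add: emeasure_eq_ennreal_measure)
  finally show "(\<integral>\<^sup>+\<omega>. ennreal (real (card {n. t n \<omega> \<in> B})) \<partial>M) = ennreal (mean_intensity * measure lborel B)"
    by (simp add: ennreal_mult mean_intensity_def)
qed (simp_all add: mean_intensity_def)

end

section \<open>Sampling a process whose covariance vanishes at lags of at least the separation\<close>

lemma separated_times_distance:
  fixes s :: "int \<Rightarrow> real"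
  assumes "d > 0" "\<And>n. s (n + 1) - s n \<ge> d" "m \<noteq> n"
  shows "\<bar>s m - s n\<bar> \<ge> d"
proof -
  have *: "s j - s i \<ge> d" if "i < j" for i j
    using that
  proof (induction j rule: int_gr_induct)
    case (step j)
    then show ?case
      using assms(1) assms(2)[of j] by linarith
  qed (rule assms(2))
  show ?thesis
    using *[of m n] *[of n m] assms(3) by linarith
qed

lemma integrable_mult_of_squares:
  fixes f g :: "'c \<Rightarrow> real"
  assumes [measurable]: "f \<in> borel_measurable N" "g \<in> borel_measurable N"
    and "integrable N (\<lambda>x. (f x)\<^sup>2)" "integrable N (\<lambda>x. (g x)\<^sup>2)"
  shows "integrable N (\<lambda>x. f x * g x)"
proof (rule Bochner_Integration.integrable_bound)
  show "integrable N (\<lambda>x. (f x)\<^sup>2 + (g x)\<^sup>2)"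
    using assms(3,4) by simp
  have "\<bar>a * b\<bar> \<le> a\<^sup>2 + b\<^sup>2" for a b :: real
  proof -
    have "0 \<le> (\<bar>a\<bar> - \<bar>b\<bar>)\<^sup>2 + \<bar>a * b\<bar>"
      by simp
    also have "\<dots> = a\<^sup>2 + b\<^sup>2 - \<bar>a * b\<bar>"
      by (simp add: power2_diff abs_mult)
    finally show ?thesis
      by simp
  qed
  then show "AE x in N. norm (f x * g x) \<le> norm ((f x)\<^sup>2 + (g x)\<^sup>2)"
    by simp
qed measurable

lemma wss_process_products:
  assumes "wss_process Q X"
  shows "X r \<in> borel_measurable Q"
    and "integrable Q (\<lambda>\<omega>. X r \<omega> * X s \<omega>)"
    and "(\<integral>\<omega>. X r \<omega> * X s \<omega> \<partial>Q) = covariance_function Q X (r - s)"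
proof -
  have joint: "case_prod X \<in> borel_measurable (borel \<Otimes>\<^sub>M Q)"
    and square: "integrable Q (\<lambda>\<omega>. (X t \<omega>)\<^sup>2)"
    and stat: "(\<integral>\<omega>. X (s + t) \<omega> * X s \<omega> \<partial>Q) = (\<integral>\<omega>. X (s' + t) \<omega> * X s' \<omega> \<partial>Q)" for t s s'
    using assms unfolding wss_process_def by blast+
  have X[measurable]: "X r \<in> borel_measurable Q" for r
    using measurable_Pair2[OF joint, of r] by simp
  show "X r \<in> borel_measurable Q"
    by (rule X)
  show "integrable Q (\<lambda>\<omega>. X r \<omega> * X s \<omega>)"
    by (intro integrable_mult_of_squares X square)
  show "(\<integral>\<omega>. X r \<omega> * X s \<omega> \<partial>Q) = covariance_function Q X (r - s)"
    using stat[of s "r - s" 0] by (simp add: covariance_function_def)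
qed

context stationary_sampling
begin

text \<open>
  The set of summed indices depends on the sample point. Where it is finite, the sum is
  the limit of sums over the fixed index sets \<open>{- N..N}\<close>; where it is infinite, the sum is \<open>0\<close>.
\<close>

lemma borel_measurable_compound_process:
  assumes X: "case_prod X \<in> borel_measurable (borel \<Otimes>\<^sub>M Q)" and B [measurable]: "B \<in> sets borel"
  shows "compound_process t X B \<in> borel_measurable (M \<Otimes>\<^sub>M Q)"
proof -
  have eq: "compound_process t X B z =
    (if count_in t B (fst z) \<noteq> \<infinity>
     then lim (\<lambda>N. \<Sum>n\<in>{- int N..int N}. indicator B (t n (fst z)) * X (t n (fst z)) (snd z))
     else 0)" for z
  proof (cases "finite {n. t n (fst z) \<in> B}")
    case False
    then show ?thesis
      by (simp add: compound_process_def count_in_def case_prod_beta)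
  next
    case True
    let ?F = "{n. t n (fst z) \<in> B}"
    obtain K where K: "\<bar>n\<bar> \<le> int K" if "n \<in> ?F" for n
    proof
      fix n assume "n \<in> ?F"
      then have "\<bar>n\<bar> \<le> (\<Sum>m\<in>?F. \<bar>m\<bar>)"
        using True by (intro member_le_sum) auto
      then show "\<bar>n\<bar> \<le> int (nat (\<Sum>m\<in>?F. \<bar>m\<bar>))"
        by simp
    qed
    have "(\<Sum>n\<in>{- int N..int N}. indicator B (t n (fst z)) * X (t n (fst z)) (snd z))
        = (\<Sum>n\<in>?F. X (t n (fst z)) (snd z))" if "N \<ge> K" for N
    proof -
      have "?F \<subseteq> {- int N..int N}"
        using K that by force
      then show ?thesis
        by (intro sum.mono_neutral_cong_right) auto
    qed
    then have "(\<lambda>N. \<Sum>n\<in>{- int N..int N}. indicator B (t n (fst z)) * X (t n (fst z)) (snd z))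
        \<longlonglongrightarrow> (\<Sum>n\<in>?F. X (t n (fst z)) (snd z))"
      by (intro tendsto_eventually eventually_sequentiallyI)
    then show ?thesis
      using True by (simp add: limI compound_process_def count_in_def case_prod_beta)
  qed
  have [measurable]: "(\<lambda>z. X (t n (fst z)) (snd z)) \<in> borel_measurable (M \<Otimes>\<^sub>M Q)" for n
    using measurable_compose[OF _ X, of "\<lambda>z. (t n (fst z), snd z)" "M \<Otimes>\<^sub>M Q"] by simp
  show ?thesis
    unfolding eq[abs_def] by measurable
qed

text \<open>
  Given the sampling times, the expectation of \<open>Z A * Z B\<close> is the sum of \<open>C (t i - t j)\<close> over
  the sampling times \<open>t i\<close> in \<open>A\<close> and \<open>t j\<close> in \<open>B\<close>. Terms with \<open>i \<noteq> j\<close> vanish because such times are at least \<open>d\<close>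
  apart, which leaves \<open>C 0\<close> times the number of sampling times in \<open>A \<inter> B\<close>. Averaging over the sampling
  times gives a multiple of the length of \<open>A \<inter> B\<close>, the covariance of a process with orthogonal
  increments, and its reduced covariance measure is an atom at \<open>0\<close>.
\<close>

lemma reduced_covariance_measure_compound_process:
  assumes "d > 0" "separated_times d M t"
    and wss: "wss_process Q X"
    and short: "\<And>u. \<bar>u\<bar> \<ge> d \<Longrightarrow> covariance_function Q X u = 0"
  shows "reduced_covariance_measure (M \<Otimes>\<^sub>M Q) (compound_process t X)
    (\<lambda>B. covariance_function Q X 0 * mean_intensity * indicator B 0)"
proof -
  let ?C = "covariance_function Q X" and ?Z = "compound_process t X" and ?P = "M \<Otimes>\<^sub>M Q"
  let ?F = "\<lambda>\<omega> B. {n. t n \<omega> \<in> B}"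
  interpret Q: prob_space Q
    using wss by (simp add: wss_process_def)
  interpret pair_prob_space M Q ..
  note prods = wss_process_products[OF wss]
  have joint: "case_prod X \<in> borel_measurable (borel \<Otimes>\<^sub>M Q)" and mean: "(\<integral>\<omega>'. X r \<omega>' \<partial>Q) = 0" for r
    using wss by (auto simp: wss_process_def)
  have intX: "integrable Q (X r)" for r
    using prods(2)[of r r] by (simp add: Q.square_integrable_imp_integrable[OF prods(1)] power2_eq_square)
  have Z_meas [measurable]: "?Z B \<in> borel_measurable ?P" if "B \<in> bounded_borel" for B
    using that by (intro borel_measurable_compound_process joint) simp
  have separated: "AE \<omega> in M. \<forall>m n. m \<noteq> n \<longrightarrow> \<bar>t m \<omega> - t n \<omega>\<bar> \<ge> d"
    using assms(2) unfolding separated_times_def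
  proof eventually_elim
    case (elim \<omega>)
    then show ?case
      using separated_times_distance[OF assms(1), of "\<lambda>n. t n \<omega>"] by simp
  qed
  \<comment> \<open>conditional second moments given the sampling times: only the diagonal \<open>i = j\<close> survives\<close>
  have conditional: "AE \<omega> in M. integrable Q (\<lambda>\<omega>'. ?Z A (\<omega>, \<omega>') * ?Z B (\<omega>, \<omega>')) \<and>
      (\<integral>\<omega>'. ?Z A (\<omega>, \<omega>') * ?Z B (\<omega>, \<omega>') \<partial>Q) = ?C 0 * real (card (?F \<omega> (A \<inter> B)))"
    if A: "A \<in> bounded_borel" and B: "B \<in> bounded_borel" for A B
    using AE_finite_count[OF A] AE_finite_count[OF B] separated
  proof eventually_elim
    case (elim \<omega>)
    have expand: "?Z A (\<omega>, \<omega>') * ?Z B (\<omega>, \<omega>') = (\<Sum>i\<in>?F \<omega> A. \<Sum>j\<in>?F \<omega> B. X (t i \<omega>) \<omega>' * X (t j \<omega>) \<omega>')" for \<omega>'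
      by (simp add: compound_process_def sum_product)
    have "(\<integral>\<omega>'. ?Z A (\<omega>, \<omega>') * ?Z B (\<omega>, \<omega>') \<partial>Q) = (\<Sum>i\<in>?F \<omega> A. \<Sum>j\<in>?F \<omega> B. ?C (t i \<omega> - t j \<omega>))"
      unfolding expand by (simp add: prods)
    also have "\<dots> = (\<Sum>i\<in>?F \<omega> A. \<Sum>j\<in>?F \<omega> B. if j = i then ?C 0 else 0)"
      using elim(3) by (intro sum.cong refl) (auto intro: short)
    also have "\<dots> = (\<Sum>i\<in>?F \<omega> A. if i \<in> ?F \<omega> B then ?C 0 else 0)"
      using elim(2) by (simp add: sum.delta)
    also have "\<dots> = (\<Sum>i\<in>?F \<omega> (A \<inter> B). ?C 0)"
      using elim(1) by (intro sum.mono_neutral_cong_right) auto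
    also have "\<dots> = ?C 0 * real (card (?F \<omega> (A \<inter> B)))"
      by simp
    finally show ?case
      unfolding expand by (simp add: prods)
  qed
  have count_integral: "has_bochner_integral M (\<lambda>\<omega>. ?C 0 * real (card (?F \<omega> D))) (?C 0 * (mean_intensity * measure lborel D))"
    if "D \<in> bounded_borel" for D
    by (intro has_bochner_integral_mult_right has_bochner_integral_count that)
  have square: "integrable ?P (\<lambda>z. (?Z B z)\<^sup>2)" if B: "B \<in> bounded_borel" for B
  proof (rule Fubini_integrable)
    show "(\<lambda>z. (?Z B z)\<^sup>2) \<in> borel_measurable ?P"
      using Z_meas[OF B] by measurable
    show "AE \<omega> in M. integrable Q (\<lambda>\<omega>'. (?Z B (\<omega>, \<omega>'))\<^sup>2)"
      using conditional[OF B B] by eventually_elim (simp add: power2_eq_square)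
    have eq: "AE \<omega> in M. (\<integral>\<omega>'. norm ((?Z B (\<omega>, \<omega>'))\<^sup>2) \<partial>Q) = ?C 0 * real (card (?F \<omega> B))"
      using conditional[OF B B] by eventually_elim (simp add: power2_eq_square)
    have count: "integrable M (\<lambda>\<omega>. ?C 0 * real (card (?F \<omega> B)))"
      using count_integral[OF B] by (simp only: has_bochner_integral_iff)
    have "(\<lambda>\<omega>. \<integral>\<omega>'. norm ((?Z B (\<omega>, \<omega>'))\<^sup>2) \<partial>Q) \<in> borel_measurable M"
      using Z_meas[OF B] by measurable
    from integrable_cong_AE[OF this borel_measurable_integrable[OF count] eq] count
    show "integrable M (\<lambda>\<omega>. \<integral>\<omega>'. norm ((?Z B (\<omega>, \<omega>'))\<^sup>2) \<partial>Q)"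
      by (rule iffD2)
  qed
  have prod_int: "integrable ?P (\<lambda>z. ?Z A z * ?Z B z)" if A: "A \<in> bounded_borel" and B: "B \<in> bounded_borel" for A B
    using A B by (intro integrable_mult_of_squares Z_meas square)
  have Z_mean: "(\<integral>z. ?Z B z \<partial>?P) = 0" if B: "B \<in> bounded_borel" for B
  proof -
    have "integrable ?P (?Z B)"
      by (rule P.square_integrable_imp_integrable[OF Z_meas[OF B] square[OF B]])
    then have "(\<integral>z. ?Z B z \<partial>?P) = (\<integral>\<omega>. \<integral>\<omega>'. ?Z B (\<omega>, \<omega>') \<partial>Q \<partial>M)"
      by (rule integral_fst'[symmetric])
    also have "(\<lambda>\<omega>. \<integral>\<omega>'. ?Z B (\<omega>, \<omega>') \<partial>Q) = (\<lambda>\<omega>. 0)"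
      by (simp add: compound_process_def intX mean)
    finally show ?thesis
      by simp
  qed
  have covariance: "cov ?P (?Z A) (?Z B) = ?C 0 * (mean_intensity * measure lborel (A \<inter> B))"
    if A: "A \<in> bounded_borel" and B: "B \<in> bounded_borel" for A B
  proof -
    have AB: "A \<inter> B \<in> bounded_borel"
      using A B by (auto intro: bounded_Int)
    have "cov ?P (?Z A) (?Z B) = (\<integral>\<omega>. \<integral>\<omega>'. ?Z A (\<omega>, \<omega>') * ?Z B (\<omega>, \<omega>') \<partial>Q \<partial>M)"
      unfolding cov_def Z_mean[OF A] Z_mean[OF B] using integral_fst'[OF prod_int[OF A B]] by simp
    also have "\<dots> = (\<integral>\<omega>. ?C 0 * real (card (?F \<omega> (A \<inter> B))) \<partial>M)"
    proof (rule integral_cong_AE)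
      show "AE \<omega> in M. (\<integral>\<omega>'. ?Z A (\<omega>, \<omega>') * ?Z B (\<omega>, \<omega>') \<partial>Q) = ?C 0 * real (card (?F \<omega> (A \<inter> B)))"
        using conditional[OF A B] by eventually_elim simp
      show "(\<lambda>\<omega>. ?C 0 * real (card (?F \<omega> (A \<inter> B)))) \<in> borel_measurable M"
        using count_integral[OF AB] by (auto simp: has_bochner_integral_iff)
    qed (use Z_meas[OF A] Z_meas[OF B] in measurable)
    also have "\<dots> = ?C 0 * (mean_intensity * measure lborel (A \<inter> B))"
      using count_integral[OF AB] by (rule has_bochner_integral_integral_eq)
    finally show ?thesis .
  qed
  \<comment> \<open>the integral of an atom at \<open>0\<close> over the translates \<open>B - x\<close>, \<open>x \<in> A\<close>, measures \<open>A \<inter> B\<close>\<close>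
  have atom: "indicator ((\<lambda>b. b - x) ` B) 0 = (indicator B x :: real)" for B and x :: real
    by (auto simp: indicator_def)
  show ?thesis
    unfolding reduced_covariance_measure_def
  proof (intro conjI ballI)
    show "signed_measure_on_bounded (\<lambda>B. ?C 0 * mean_intensity * indicator B 0)"
      unfolding signed_measure_on_bounded_def
      by (intro allI impI sums_mult indicator_sums) (auto simp: disjoint_family_on_def)
  next
    fix B assume B: "B \<in> bounded_borel"
    show "?Z B \<in> borel_measurable ?P" "integrable ?P (\<lambda>z. (?Z B z)\<^sup>2)"
      using B square by auto
  next
    fix A B assume A: "A \<in> bounded_borel" and B: "B \<in> bounded_borel"
    have AB: "A \<inter> B \<in> sets lborel" "emeasure lborel (A \<inter> B) < \<infinity>"
      using A B emeasure_bounded_finite[of "A \<inter> B"] by (auto intro: bounded_Int)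
    have integral: "has_bochner_integral lborel (\<lambda>x. indicator A x *\<^sub>R (?C 0 * mean_intensity * indicator ((\<lambda>b. b - x) ` B) 0))
        (?C 0 * mean_intensity * measure lborel (A \<inter> B))"
      using has_bochner_integral_mult_right[OF has_bochner_integral_real_indicator[OF AB], of "?C 0 * mean_intensity"]
      by (simp add: atom indicator_inter_arith mult_ac)
    show "set_integrable lborel A (\<lambda>x. ?C 0 * mean_intensity * indicator ((\<lambda>b. b - x) ` B) 0)"
      using integral by (simp add: set_integrable_def has_bochner_integral_iff)
    show "cov ?P (?Z A) (?Z B) = (LINT x:A|lborel. ?C 0 * mean_intensity * indicator ((\<lambda>b. b - x) ` B) 0)"
      unfolding covariance[OF A B] set_lebesgue_integral_def has_bochner_integral_integral_eq[OF integral]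
      by (simp only: mult.assoc)
  qed
qed

end

section \<open>Stationary random waves with a prescribed spectrum\<close>

text \<open>
  A sample point consists of a frequency \<open>l\<close> with law \<open>\<Phi>\<close> and an independent number \<open>k\<close> of quarter turns
  by which the phase is shifted. Four equally likely phases suffice for stationarity: they already make
  the averages of \<open>cos (x + phase)\<close> and of \<open>cos (x + 2 * phase)\<close> vanish, as a uniformly distributed
  phase would. The factor \<open>sqrt 2\<close> below normalizes the variance to \<open>1\<close>.
\<close>

definition wave_space :: "real measure \<Rightarrow> (real \<times> real) measure" where
  "wave_space \<Phi> = \<Phi> \<Otimes>\<^sub>M measure_pmf (pmf_of_set {0, 1, 2, 3})"

definition random_wave :: "real \<Rightarrow> real \<times> real \<Rightarrow> real" where
  "random_wave t = (\<lambda>(l, k). sqrt 2 * cos (l * t + k * (pi / 2)))"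

lemma sum_cos_quarter_turns:
  fixes x y :: real
  shows "(\<Sum>k\<in>{0, 1, 2, 3}. cos (x + k * (pi / 2))) = 0"
    and "(\<Sum>k\<in>{0, 1, 2, 3}. cos (x + k * (pi / 2)) * cos (y + k * (pi / 2))) = 2 * cos (x - y)"
proof -
  have "3 * (pi / 2) = pi + pi / 2"
    by simp
  then have [simp]: "cos (3 * (pi / 2)) = 0" "sin (3 * (pi / 2)) = - 1"
    by (simp_all only: cos_add sin_add) simp_all
  have [simp]: "cos (x + 3 * pi / 2) = sin x" "cos (x + pi / 2) = - sin x" for x
    using \<open>cos (3 * (pi / 2)) = 0\<close> \<open>sin (3 * (pi / 2)) = - 1\<close>
    by (simp_all add: cos_add)
  show "(\<Sum>k\<in>{0, 1, 2, 3}. cos (x + k * (pi / 2))) = 0"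
    and "(\<Sum>k\<in>{0, 1, 2, 3}. cos (x + k * (pi / 2)) * cos (y + k * (pi / 2))) = 2 * cos (x - y)"
    by (simp_all add: cos_diff)
qed

context real_distribution
begin

lemma borel_measurable_random_wave:
  "case_prod random_wave \<in> borel_measurable (borel \<Otimes>\<^sub>M wave_space M)"
proof -
  have [measurable]: "(\<lambda>x. x) \<in> borel_measurable (measure_pmf p)" for p :: "real pmf"
    by simp
  have "(\<lambda>z. snd (snd z)) \<in> borel_measurable (borel \<Otimes>\<^sub>M wave_space M)"
    unfolding wave_space_def by (rule measurable_compose[of _ _ "measure_pmf (pmf_of_set {0, 1, 2, 3})" "\<lambda>x. x"]) measurable
  moreover have "(\<lambda>z. fst (snd z)) \<in> borel_measurable (borel \<Otimes>\<^sub>M wave_space M)"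
    unfolding wave_space_def by measurable
  ultimately show ?thesis
    unfolding random_wave_def case_prod_beta by measurable
qed

lemma borel_measurable_random_wave' [measurable]: "random_wave t \<in> borel_measurable (wave_space M)"
  using measurable_Pair2[OF borel_measurable_random_wave, of t] by simp

lemma prob_space_wave_space: "prob_space (wave_space M)"
proof -
  interpret pair_prob_space M "measure_pmf (pmf_of_set {0, 1, 2, 3 :: real})" ..
  show ?thesis
    unfolding wave_space_def by (rule P.prob_space_axioms)
qed

text \<open>
  Fubini's theorem, with the integral over the phase written as an average of four values.
\<close>

lemma integral_wave_space:
  fixes f :: "real \<times> real \<Rightarrow> real"
  assumes "f \<in> borel_measurable (wave_space M)" "\<And>w. \<bar>f w\<bar> \<le> B"
  shows "integrable (wave_space M) f"
    and "(\<integral>w. f w \<partial>wave_space M) = (\<integral>l. (\<Sum>k\<in>{0, 1, 2, 3}. f (l, k)) / 4 \<partial>M)"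
proof -
  interpret W: prob_space "wave_space M"
    by (rule prob_space_wave_space)
  interpret pair_prob_space M "measure_pmf (pmf_of_set {0, 1, 2, 3 :: real})" ..
  show int: "integrable (wave_space M) f"
    using assms by (intro W.integrable_const_bound[of _ B]) auto
  have "(\<integral>w. f w \<partial>wave_space M) = (\<integral>l. \<integral>k. f (l, k) \<partial>measure_pmf (pmf_of_set {0, 1, 2, 3}) \<partial>M)"
    using int unfolding wave_space_def by (rule integral_fst'[symmetric])
  then show "(\<integral>w. f w \<partial>wave_space M) = (\<integral>l. (\<Sum>k\<in>{0, 1, 2, 3}. f (l, k)) / 4 \<partial>M)"
    by (subst (asm) integral_pmf_of_set) (simp_all del: sum.insert)
qed

lemma abs_random_wave_le: "\<bar>random_wave t w\<bar> \<le> sqrt 2"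
  by (simp add: random_wave_def abs_mult split: prod.split)

text \<open>
  Averaging the product of two cosines over the phase keeps the cosine of the difference of the arguments
  and cancels that of their sum, so the result depends on \<open>s\<close> and \<open>t\<close> only through \<open>s - t\<close>.
\<close>

lemma random_wave_products:
  shows "integrable (wave_space M) (\<lambda>w. random_wave s w * random_wave t w)"
    and "(\<integral>w. random_wave s w * random_wave t w \<partial>wave_space M) = Re (char M (s - t))"
proof -
  have bound: "\<bar>random_wave s w * random_wave t w\<bar> \<le> sqrt 2 * sqrt 2" for w
    unfolding abs_mult by (intro mult_mono abs_random_wave_le) auto
  note I = integral_wave_space[OF _ bound]
  show "integrable (wave_space M) (\<lambda>w. random_wave s w * random_wave t w)"
    by (rule I) measurable
  have "(\<Sum>k\<in>{0, 1, 2, 3}. random_wave s (l, k) * random_wave t (l, k)) / 4 = cos ((s - t) * l)" for l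
  proof -
    have "(\<Sum>k\<in>{0, 1, 2, 3}. random_wave s (l, k) * random_wave t (l, k))
      = 2 * (\<Sum>k\<in>{0, 1, 2, 3}. cos (l * s + k * (pi / 2)) * cos (l * t + k * (pi / 2)))"
      unfolding sum_distrib_left by (intro sum.cong) (simp_all add: random_wave_def)
    then show ?thesis
      unfolding sum_cos_quarter_turns by (simp add: algebra_simps)
  qed
  then have "(\<integral>w. random_wave s w * random_wave t w \<partial>wave_space M) = (\<integral>l. cos ((s - t) * l) \<partial>M)"
    by (subst I) simp_all
  also have "\<dots> = Re (char M (s - t))"
    unfolding char_def
    by (subst integral_Re[symmetric]) (auto simp: Re_exp intro!: integrable_iexp Bochner_Integration.integral_cong)
  finally show "(\<integral>w. random_wave s w * random_wave t w \<partial>wave_space M) = Re (char M (s - t))" .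
qed

text \<open>
  Mean square continuity is continuity of the characteristic function at \<open>0\<close>, since the mean
  square increment between \<open>s\<close> and \<open>t\<close> is \<open>2 - 2 * Re (char M (s - t))\<close>.
\<close>

lemma wss_process_random_wave: "wss_process (wave_space M) random_wave"
  unfolding wss_process_def
proof (intro conjI allI)
  show "prob_space (wave_space M)"
    by (rule prob_space_wave_space)
  show "case_prod random_wave \<in> borel_measurable (borel \<Otimes>\<^sub>M wave_space M)"
    by (rule borel_measurable_random_wave)
  show "integrable (wave_space M) (\<lambda>w. (random_wave t w)\<^sup>2)" for t
    using random_wave_products(1)[of t t] by (simp add: power2_eq_square)
  have "(\<Sum>k\<in>{0, 1, 2, 3}. random_wave t (l, k)) = 0" for l t
  proof -
    have "(\<Sum>k\<in>{0, 1, 2, 3}. random_wave t (l, k)) = sqrt 2 * (\<Sum>k\<in>{0, 1, 2, 3}. cos (l * t + k * (pi / 2)))"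
      unfolding sum_distrib_left by (intro sum.cong) (simp_all add: random_wave_def)
    then show ?thesis
      unfolding sum_cos_quarter_turns by simp
  qed
  then show "(\<integral>w. random_wave t w \<partial>wave_space M) = 0" for t
    by (subst integral_wave_space[OF _ abs_random_wave_le]) simp_all
  show "(\<integral>w. random_wave (s + t) w * random_wave s w \<partial>wave_space M)
      = (\<integral>w. random_wave (s' + t) w * random_wave s' w \<partial>wave_space M)" for s s' t
    by (simp add: random_wave_products)
  show "((\<lambda>s. \<integral>w. (random_wave s w - random_wave t w)\<^sup>2 \<partial>wave_space M) \<longlongrightarrow> 0) (at t)" for t
  proof -
    have "(\<integral>w. (random_wave s w - random_wave t w)\<^sup>2 \<partial>wave_space M)
        = 2 - 2 * Re (char M (s - t))" for s
    proof -
      have "(random_wave s w - random_wave t w)\<^sup>2 = random_wave s w * random_wave s w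
          + random_wave t w * random_wave t w - 2 * (random_wave s w * random_wave t w)" for w
        by (simp add: power2_eq_square algebra_simps)
      then show ?thesis
        using random_wave_products by (simp add: char_zero)
    qed
    moreover have "((\<lambda>s. 2 - 2 * Re (char M (s - t))) \<longlongrightarrow> 2 - 2 * Re (char M (t - t))) (at t)"
    proof (intro tendsto_intros)
      have "isCont (\<lambda>s. char M (s - t)) t"
        by (rule isCont_o2[OF _ isCont_char]) (intro continuous_intros)
      then show "((\<lambda>s. char M (s - t)) \<longlongrightarrow> char M (t - t)) (at t)"
        by (simp add: isCont_def)
    qed
    ultimately show ?thesis
      by (simp add: char_zero)
  qed
qed

lemma covariance_function_random_wave: "covariance_function (wave_space M) random_wave t = Re (char M t)"
  using random_wave_products(2)[of t 0] by (simp add: covariance_function_def)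

lemma spectrum_of_random_wave:
  assumes "\<And>t. Im (char M t) = 0"
  shows "spectrum_of (wave_space M) random_wave M"
  using assms by (simp add: spectrum_of_def covariance_function_random_wave complex_eq_iff finite_measure_axioms)

lemma in_all_spectra:
  assumes "\<And>t. Im (char M t) = 0"
  shows "M \<in> all_spectra TYPE(real \<times> real)"
  using wss_process_random_wave spectrum_of_random_wave[OF assms] by (auto simp: all_spectra_def)

end

section \<open>Spectra with triangular covariance functions\<close>

text \<open>
  The Fejer kernel, normalized to total mass \<open>1\<close>. At \<open>x = 0\<close> its value is \<open>0\<close> instead of the limit
  \<open>a / (2 * pi)\<close>, which changes it only on a null set.
\<close>

definition fejer_density :: "real \<Rightarrow> real \<Rightarrow> real" where
  "fejer_density a x = (1 - cos (a * x)) / (pi * a * x\<^sup>2)"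

text \<open>
  Integration by parts reduces this to the sine integral: \<open>Si x - (1 - cos x) / x\<close> is an
  antiderivative on the positive half-line, and \<^const>\<open>Si\<close> tends to \<open>pi / 2\<close> at infinity. The other half-line
  contributes the same amount because the integrand is even.
\<close>

lemma has_bochner_integral_one_minus_cos_over_square:
  "has_bochner_integral lborel (\<lambda>x::real. (1 - cos x) / x\<^sup>2) pi"
proof -
  let ?F = "\<lambda>x::real. Si x - (1 - cos x) / x"
  have deriv: "DERIV ?F x :> (1 - cos x) / x\<^sup>2" if "0 < ereal x" "ereal x < \<infinity>" for x
    using that
    by (auto intro!: derivative_eq_intros DERIV_Si simp: field_simps power2_eq_square)
  have cont: "isCont (\<lambda>x. (1 - cos x) / x\<^sup>2) x" if "0 < ereal x" for x :: real
    using that by (auto intro!: continuous_intros)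
  have Si0: "Si 0 = 0"
    using Si_neg[of 0] by (simp add: Si_def)
  have "(?F \<longlongrightarrow> Si 0 - 0) (at_right 0)"
  proof (intro tendsto_diff)
    show "(Si \<longlongrightarrow> Si 0) (at_right 0)"
      using isCont_Si[of 0] by (auto simp: isCont_def intro: tendsto_within_subset)
    show "((\<lambda>x::real. (1 - cos x) / x) \<longlongrightarrow> 0) (at_right 0)"
    proof -
      have "((\<lambda>x::real. cos x) has_real_derivative 0) (at 0)"
        by (auto intro!: derivative_eq_intros)
      then have "((\<lambda>x::real. (cos x - 1) / x) \<longlongrightarrow> 0) (at 0)"
        by (simp add: has_field_derivative_iff)
      then have "((\<lambda>x::real. - ((cos x - 1) / x)) \<longlongrightarrow> - 0) (at 0)"
        by (rule tendsto_minus)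
      then have "((\<lambda>x::real. (1 - cos x) / x) \<longlongrightarrow> 0) (at 0)"
        by (simp add: minus_divide_left)
      then show ?thesis
        by (rule tendsto_within_subset) simp
    qed
  qed
  then have left: "((?F \<circ> real_of_ereal) \<longlongrightarrow> 0) (at_right 0)"
    by (simp add: zero_ereal_def ereal_tendsto_simps Si0)
  have "((\<lambda>x::real. (1 - cos x) / x) \<longlongrightarrow> 0) at_top"
  proof (rule Lim_null_comparison)
    show "\<forall>\<^sub>F x::real in at_top. norm ((1 - cos x) / x) \<le> 2 / x"
      using eventually_gt_at_top[of 0]
    proof eventually_elim
      case (elim x)
      then show ?case
        using cos_ge_minus_one[of x] cos_le_one[of x] by (simp add: divide_right_mono del: cos_ge_minus_one cos_le_one)
    qed
    show "((\<lambda>x::real. 2 / x) \<longlongrightarrow> 0) at_top"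
      by (intro tendsto_divide_0[OF tendsto_const] filterlim_at_top_imp_at_infinity filterlim_ident)
  qed
  then have "(?F \<longlongrightarrow> pi / 2 - 0) at_top"
    by (intro tendsto_diff Si_at_top)
  then have right: "((?F \<circ> real_of_ereal) \<longlongrightarrow> pi / 2) (at_left \<infinity>)"
    by (simp add: ereal_tendsto_simps)
  note FTC = interval_integral_FTC_nonneg[of 0 \<infinity> ?F "\<lambda>x. (1 - cos x) / x\<^sup>2", OF _ deriv cont _ left right]
  have "set_integrable lborel {0<..} (\<lambda>x::real. (1 - cos x) / x\<^sup>2)"
    using FTC(1) by (simp add: zero_ereal_def)
  moreover have "(LBINT x:{0<..}. (1 - cos x) / x\<^sup>2) = pi / 2"
    using FTC(2) by (simp add: interval_integral_Ioi zero_ereal_def)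
  ultimately have "has_bochner_integral lborel (\<lambda>x::real. indicator {0<..} x *\<^sub>R ((1 - cos x) / x\<^sup>2)) (pi / 2)"
    by (simp add: has_bochner_integral_iff set_integrable_def set_lebesgue_integral_def)
  then have "has_bochner_integral lborel (\<lambda>x::real. indicator {0..} x *\<^sub>R ((1 - cos x) / x\<^sup>2)) (pi / 2)"
    by (rule has_bochner_integral_cong[THEN iffD1, rotated 3]) (auto split: split_indicator)
  from has_bochner_integral_even_function[OF this] show ?thesis
    by simp
qed

lemma has_bochner_integral_one_minus_cos_scaled:
  "has_bochner_integral lborel (\<lambda>x. (1 - cos (b * x)) / x\<^sup>2) (pi * \<bar>b\<bar>)"
proof (cases "b = 0")
  case False
  from lborel_has_bochner_integral_real_affine_iff[OF False, THEN iffD1, OF has_bochner_integral_one_minus_cos_over_square, of 0]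
  have "has_bochner_integral lborel (\<lambda>x. b\<^sup>2 * ((1 - cos (b * x)) / (b * x)\<^sup>2)) (b\<^sup>2 * (pi / \<bar>b\<bar>))"
    by (intro has_bochner_integral_mult_right) (simp add: divide_inverse_commute)
  moreover have "b\<^sup>2 * (pi / \<bar>b\<bar>) = pi * \<bar>b\<bar>"
    using False by (simp add: field_simps power2_eq_square flip: abs_mult)
  moreover have "b\<^sup>2 * ((1 - cos (b * x)) / (b * x)\<^sup>2) = (1 - cos (b * x)) / x\<^sup>2" for x
    using False by (simp add: power_mult_distrib)
  ultimately show ?thesis
    by simp
qed (simp add: has_bochner_integral_zero)

text \<open>
  By the product formula for cosines, \<open>cos (t * x) * (1 - cos (a * x))\<close> is a linear combination of
  \<open>1 - cos (b * x)\<close> for \<open>b = a + t\<close>, \<open>a - t\<close> and \<open>t\<close>. Each of these, divided by \<open>x\<^sup>2\<close>, has integral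
  \<open>pi * \<bar>b\<bar>\<close>, and the second difference \<open>\<bar>a + t\<bar> + \<bar>a - t\<bar> - 2 * \<bar>t\<bar>\<close> is the triangle of height
  \<open>2 * a\<close>.
\<close>

lemma has_bochner_integral_cos_fejer_density:
  assumes "a > 0"
  shows "has_bochner_integral lborel (\<lambda>x. cos (t * x) * fejer_density a x) (max 0 (1 - \<bar>t\<bar> / a))"
proof -
  let ?J = "\<lambda>b x. (1 - cos (b * x)) / x\<^sup>2 :: real"
  have "has_bochner_integral lborel (\<lambda>x. (?J (a + t) x + ?J (a - t) x - 2 * ?J t x) / (2 * pi * a))
      ((pi * \<bar>a + t\<bar> + pi * \<bar>a - t\<bar> - 2 * (pi * \<bar>t\<bar>)) / (2 * pi * a))"
    by (intro has_bochner_integral_divide_zero has_bochner_integral_diff has_bochner_integral_add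
        has_bochner_integral_mult_right has_bochner_integral_one_minus_cos_scaled)
  moreover have "(?J (a + t) x + ?J (a - t) x - 2 * ?J t x) / (2 * pi * a) = cos (t * x) * fejer_density a x" for x
    using assms
    by (cases "x = 0") (simp_all add: fejer_density_def distrib_right left_diff_distrib cos_add cos_diff field_simps)
  moreover have "(pi * \<bar>a + t\<bar> + pi * \<bar>a - t\<bar> - 2 * (pi * \<bar>t\<bar>)) / (2 * pi * a) = max 0 (1 - \<bar>t\<bar> / a)"
    using assms by (auto simp: abs_if max_def field_simps)
  ultimately show ?thesis
    by simp
qed

lemma fejer_density_nonneg: "a > 0 \<Longrightarrow> fejer_density a x \<ge> 0"
  by (simp add: fejer_density_def)

lemma borel_measurable_fejer_density [measurable]: "fejer_density a \<in> borel_measurable borel"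
  unfolding fejer_density_def by measurable

definition fejer_distribution :: "real \<Rightarrow> real measure" where
  "fejer_distribution a = density lborel (fejer_density a)"

lemma real_distribution_fejer:
  assumes "a > 0"
  shows "real_distribution (fejer_distribution a)"
proof -
  have *: "has_bochner_integral lborel (fejer_density a) 1"
    using has_bochner_integral_cos_fejer_density[OF assms, of 0] by simp
  have "emeasure (fejer_distribution a) (space (fejer_distribution a)) = (\<integral>\<^sup>+x. fejer_density a x \<partial>lborel)"
    by (simp add: fejer_distribution_def emeasure_density)
  also have "\<dots> = 1"
    using * fejer_density_nonneg[OF assms]
    by (simp add: nn_integral_eq_integral has_bochner_integral_iff)
  finally show ?thesis
    by (auto simp: real_distribution_def real_distribution_axioms_def fejer_distribution_def intro!: prob_spaceI)
qed

text \<open>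
  The imaginary part is the integral of an odd function and therefore vanishes.
\<close>

lemma char_fejer_distribution:
  assumes "a > 0"
  shows "char (fejer_distribution a) t = of_real (max 0 (1 - \<bar>t\<bar> / a))"
proof -
  have [simp]: "integrable lborel (fejer_density a)"
    using has_bochner_integral_cos_fejer_density[OF assms, of 0] by (simp add: has_bochner_integral_iff)
  have int: "integrable lborel (\<lambda>x. fejer_density a x *\<^sub>R iexp (t * x))"
    by (rule Bochner_Integration.integrable_bound[of _ "fejer_density a"]) (auto simp: norm_mult)
  have char: "char (fejer_distribution a) t = (CLINT x|lborel. fejer_density a x *\<^sub>R iexp (t * x))"
    unfolding char_def fejer_distribution_def
    by (rule integral_density) (auto simp: fejer_density_nonneg[OF assms])
  have "Re (char (fejer_distribution a) t) = (LBINT x. cos (t * x) * fejer_density a x)"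
    unfolding char using int
    by (subst integral_Re[symmetric]) (auto simp: Re_exp mult_ac intro!: Bochner_Integration.integral_cong)
  also have "\<dots> = max 0 (1 - \<bar>t\<bar> / a)"
    using has_bochner_integral_cos_fejer_density[OF assms, of t] by (simp add: has_bochner_integral_iff)
  finally have re: "Re (char (fejer_distribution a) t) = max 0 (1 - \<bar>t\<bar> / a)" .
  have "Im (char (fejer_distribution a) t) = (LBINT x. sin (t * x) * fejer_density a x)"
    unfolding char using int
    by (subst integral_Im[symmetric]) (auto simp: Im_exp mult_ac intro!: Bochner_Integration.integral_cong)
  moreover have "(LBINT x. sin (t * x) * fejer_density a x) = - (LBINT x. sin (t * x) * fejer_density a x)"
    by (subst lborel_integral_real_affine[where c = "-1" and t = 0]) (simp_all add: fejer_density_def)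
  ultimately show ?thesis
    using re by (simp add: complex_eq_iff)
qed

section \<open>Aliased processes\<close>

text \<open>
  The reduced covariance measure does not depend on \<open>a\<close>, although the spectrum does.
\<close>

lemma (in stationary_sampling) triangular_wave_compound_process:
  assumes "d > 0" "separated_times d M t" and "0 < a" "a \<le> d"
  defines "\<Phi> \<equiv> fejer_distribution a"
  shows "wss_process (wave_space \<Phi>) random_wave"
    and "spectrum_of (wave_space \<Phi>) random_wave \<Phi>"
    and "\<Phi> \<in> all_spectra TYPE(real \<times> real)"
    and "reduced_covariance_measure (M \<Otimes>\<^sub>M wave_space \<Phi>) (compound_process t random_wave)
      (\<lambda>B. mean_intensity * indicator B 0)"
proof -
  interpret \<Phi>: real_distribution \<Phi>
    using real_distribution_fejer[OF \<open>0 < a\<close>] by (simp add: \<Phi>_def)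
  have char: "char \<Phi> u = of_real (max 0 (1 - \<bar>u\<bar> / a))" for u
    unfolding \<Phi>_def by (rule char_fejer_distribution[OF \<open>0 < a\<close>])
  show wss: "wss_process (wave_space \<Phi>) random_wave"
    by (rule \<Phi>.wss_process_random_wave)
  show "spectrum_of (wave_space \<Phi>) random_wave \<Phi>" "\<Phi> \<in> all_spectra TYPE(real \<times> real)"
    by (simp_all add: \<Phi>.spectrum_of_random_wave \<Phi>.in_all_spectra char)
  have "covariance_function (wave_space \<Phi>) random_wave u = 0" if "\<bar>u\<bar> \<ge> d" for u
    using that assms(3,4) by (simp add: \<Phi>.covariance_function_random_wave char)
  from reduced_covariance_measure_compound_process[OF assms(1,2) wss this]
  show "reduced_covariance_measure (M \<Otimes>\<^sub>M wave_space \<Phi>) (compound_process t random_wave)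
      (\<lambda>B. mean_intensity * indicator B 0)"
    by (simp add: \<Phi>.covariance_function_random_wave char)
qed

theorem theorem2:
  fixes d :: real and M :: "'a measure" and t :: "int \<Rightarrow> 'a \<Rightarrow> real"
  assumes "d > 0"
    and "random_times M t"
    and "stationary_times M t"
    and "orderly_times M t"
    and "second_order_times M t"
    and "separated_times d M t"
  shows "\<not> alias_free TYPE(real \<times> real) M t (all_spectra TYPE(real \<times> real))"
proof -
  interpret stationary_sampling M t
    using assms(2,3,5)
    by (intro stationary_sampling.intro stationary_sampling_axioms.intro) (auto simp only: random_times_def)
  have half: "0 < d / 2" "d / 2 \<le> d"
    using assms(1) by simp_all
  \<comment> \<open>at lag \<open>d / 2\<close> the wide triangle has height \<open>1 / 2\<close> and the narrow one has just reached \<open>0\<close>\<close>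
  have "char (fejer_distribution d) (d / 2) \<noteq> char (fejer_distribution (d / 2)) (d / 2)"
    using assms(1) by (simp add: char_fejer_distribution)
  then have distinct: "fejer_distribution d \<noteq> fejer_distribution (d / 2)"
    by auto
  note full = triangular_wave_compound_process[OF assms(1,6) assms(1) order_refl]
  note halved = triangular_wave_compound_process[OF assms(1,6) half]
  show ?thesis
    unfolding alias_free_def not_not
    by (intro exI conjI)
      (rule full(1) full(2) full(3) halved(1) halved(2) halved(3) distinct full(4) halved(4))+
qed

end
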